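(* Let $k=4m+3$ for some integer $m\ge 0$. Let $$A_k=\{(x,y,z): x,y,z\in\mathbb{Z}_{\ge 0},\ y\le \lfloor \tfrac{x+z}{k}\rfloor,\ x\oplus y\oplus z=0\},$$ $$B_k=\{(x,y,z): x,y,z\in\mathbb{Z}_{\ge 0},\ y\le \lfloor \tfrac{x+z}{k}\rfloor,\ x\oplus y\oplus z\neq 0\}.$$ Then $A_k$ is the set of $\mathcal{P}$-positions and $B_k$ is the set of $\mathcal{N}$-positions of the triangular chocolate bar game with parameter $k$ (whose positions are the triples satisfying $y\le\lfloor \frac{x+z}{k}\rfloor$).
   Context: $\mathbb{Z}_{\ge0}$ is the set of non-negative integers, and $\oplus$ denotes nim-sum (bitwise XOR of binary expansions). Triangular chocolate bar game with parameter $k$: the positions are the triples $(x,y,z)\in\mathbb{Z}_{\ge0}^3$ with $y\le\lfloor\frac{x+z}{k}\rfloor$ (the three numbers are the maximal numbers of cuts of the bar in each of three directions). From a position $(x,y,z)$ the set of positions reachable in one move is $$\mathrm{move}_k((x,y,z))=\{(u,\min(y,\lfloor \tfrac{u+z}{k}\rfloor),z): 0\le u<x\}\cup\{(x,v,z): 0\le v<y\}\cup\{(x,\min(y,\lfloor \tfrac{x+w}{k}\rfloor),w): 0\le w<z\},$$ with $u,v,w$ integers. Two players move alternately; the player who moves to the terminal position $(0,0,0)$ wins (normal play: a player who cannot move loses). An $\mathcal{N}$-position is a position from which the player about to move can force a win; a $\mathcal{P}$-position is a position from which the other (previous) player can force a win. *)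

theory Defs
  imports Main
begin

unbundle bit_operations_syntax

type_synonym position = "nat \<times> nat \<times> nat"

definition positions :: "nat \<Rightarrow> position set" where
  "positions k = {(x, y, z). y \<le> (x + z) div k}"

fun move :: "nat \<Rightarrow> position \<Rightarrow> position set" where
  "move k (x, y, z) =
     {(u, min y ((u + z) div k), z) | u. u < x} \<union>
     {(x, v, z) | v. v < y} \<union>
     {(x, min y ((x + w) div k), w) | w. w < z}"

lemma move_in_positions: "p \<in> positions k \<Longrightarrow> q \<in> move k p \<Longrightarrow> q \<in> positions k"
  by (cases p) (auto simp: positions_def)

lemma terminal_iff: "move k p = {} \<longleftrightarrow> p = (0, 0, 0)"
  by (cases p) auto

lemma move_decreases:
  "(x', y', z') \<in> move k (x, y, z) \<Longrightarrow> x' + y' + z' < x + y + z"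
  by auto

text \<open>Players are named relative to the starting position: \<open>Next\<close> is about to move there.\<close>

datatype player = Next | Previous

text \<open>A history is the nonempty list of positions visited so far, the starting position first,
  so that \<open>length h - 1\<close> moves have been made.\<close>

definition player_to_move :: "position list \<Rightarrow> player" where
  "player_to_move h = (if even (length h - 1) then Next else Previous)"

text \<open>By \<open>move_decreases\<close> there are no infinite plays, so it suffices to consider finite
  lists that end in a position without moves.\<close>

definition complete_play :: "nat \<Rightarrow> position \<Rightarrow> position list \<Rightarrow> bool" where
  "complete_play k p ps \<longleftrightarrow>
     ps \<noteq> [] \<and> hd ps = p \<and>
     (\<forall>i. Suc i < length ps \<longrightarrow> ps ! Suc i \<in> move k (ps ! i)) \<and>
     move k (last ps) = {}"

text \<open>A strategy chooses the next position from the whole history. It has to choose a legal move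
  whenever there is one; without this, an illegal strategy would be followed by no play and
  would win vacuously.\<close>

definition strategy :: "nat \<Rightarrow> (position list \<Rightarrow> position) \<Rightarrow> bool" where
  "strategy k \<sigma> \<longleftrightarrow> (\<forall>h. h \<noteq> [] \<and> move k (last h) \<noteq> {} \<longrightarrow> \<sigma> h \<in> move k (last h))"

definition follows :: "player \<Rightarrow> (position list \<Rightarrow> position) \<Rightarrow> position list \<Rightarrow> bool" where
  "follows P \<sigma> ps \<longleftrightarrow>
     (\<forall>i. Suc i < length ps \<and> player_to_move (take (Suc i) ps) = P
        \<longrightarrow> ps ! Suc i = \<sigma> (take (Suc i) ps))"

text \<open>Normal play: at the end of a complete play the player who would have to move loses.\<close>

definition can_force_win :: "nat \<Rightarrow> player \<Rightarrow> position \<Rightarrow> bool" where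
  "can_force_win k P p \<longleftrightarrow>
     (\<exists>\<sigma>. strategy k \<sigma> \<and>
        (\<forall>ps. complete_play k p ps \<and> follows P \<sigma> ps \<longrightarrow> player_to_move ps \<noteq> P))"

definition N_positions :: "nat \<Rightarrow> position set" where
  "N_positions k = {p \<in> positions k. can_force_win k Next p}"

definition P_positions :: "nat \<Rightarrow> position set" where
  "P_positions k = {p \<in> positions k. can_force_win k Previous p}"

end

theory Submission
  imports Defs
begin

text \<open>
  Write k = 2n + 1 with n = 2m + 1 odd. Since a + b = (a XOR b) + 2 (a AND b), for x = z XOR s the
  condition s \<le> (x + z) div k amounts to n s \<le> c and (x + z) div k \<le> s to
  c \<le> n (s + 1), where c = x AND z is what \<open>common_bits\<close> computes from z and s.

  A move between two positions of nim-sum zero would have to lower y to y' = (u + z) div k. At the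
  highest bit d where y and y' differ, z has bit 0, so c div 2^d is the same even number for both,
  while the two inequalities squeeze it to n times an odd number.

  From a position of nonzero nim-sum the usual Nim move works unless it forces y down. In that case
  a discrete intermediate value argument gives s with n s \<le> c(s) but n (s + 1) > c(s + 1), and
  such an s automatically satisfies (u + z) div k = s for u = z XOR s. Starting the search from y
  with its low bits cleared keeps u < x.
\<close>

section \<open>Binary digits and nim-sums\<close>

lemma add_eq_xor_and:
  fixes a b :: nat
  shows "a + b = (a XOR b) + 2 * (a AND b)"
proof (induction a arbitrary: b rule: less_induct)
  case (less a)
  show ?case
  proof (cases "a = 0")
    case False
    then have "a div 2 + b div 2 = (a div 2 XOR b div 2) + 2 * (a div 2 AND b div 2)"
      using less.IH[of "a div 2" "b div 2"] by simp
    then show ?thesis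
      unfolding xor_rec[of a b] and_rec[of a b]
      by (cases "odd a"; cases "odd b") (auto elim!: evenE oddE)
  qed simp
qed

text \<open>Halving both numbers lowers \<open>d\<close> by one until the halves agree; then
  \<open>a\<close> is even and \<open>b\<close> odd. With the converse below, comparing nim-sums
  reduces to looking at a single bit.\<close>

lemma less_imp_highest_differing_bit:
  fixes a b :: nat
  assumes "a < b"
  obtains d where "\<not> bit a d" "bit b d" "a div 2 ^ Suc d = b div 2 ^ Suc d"
proof -
  have "\<exists>d. \<not> bit a d \<and> bit b d \<and> a div 2 ^ Suc d = b div 2 ^ Suc d"
    using assms
  proof (induction b arbitrary: a rule: less_induct)
    case (less b)
    show ?case
    proof (cases "a div 2 = b div 2")
      case True
      with less.prems have "even a" "odd b"
        by presburger+
      with True show ?thesis by (intro exI[of _ 0]) (simp add: bit_0)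
    next
      case False
      with less.prems have "a div 2 < b div 2" "b div 2 < b"
        by (auto simp: le_neq_implies_less div_le_mono)
      from less.IH[OF this(2,1)] obtain d where
        "\<not> bit (a div 2) d" "bit (b div 2) d" "a div 2 div 2 ^ Suc d = b div 2 div 2 ^ Suc d"
        by blast
      moreover have "c div 2 div 2 ^ Suc d = c div 2 ^ Suc (Suc d)" for c :: nat
        by (metis div_mult2_eq power_Suc)
      ultimately show ?thesis
        by (intro exI[of _ "Suc d"]) (simp add: bit_Suc del: power_Suc)
    qed
  qed
  with that show ?thesis by blast
qed

lemma div_power_bit:
  fixes a :: nat
  shows "a div 2 ^ d = 2 * (a div 2 ^ Suc d) + of_bool (bit a d)"
proof -
  have "a div 2 ^ Suc d = a div 2 ^ d div 2"
    by (simp only: power_Suc2 div_mult2_eq)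
  then show ?thesis
    by (simp add: bit_iff_odd)
qed

lemma highest_differing_bit_imp_less:
  fixes a b :: nat
  assumes "\<not> bit a d" "bit b d" "a div 2 ^ Suc d = b div 2 ^ Suc d"
  shows "a < b"
proof -
  have "a div 2 ^ d < b div 2 ^ d"
    using assms by (simp only: div_power_bit[of a d] div_power_bit[of b d]) simp
  then show ?thesis
    by (meson div_le_mono leD leI)
qed

lemma xor_div_power: "(a XOR b) div 2 ^ d = (a div 2 ^ d) XOR (b div 2 ^ d :: nat)"
  using drop_bit_xor[of d a b] by (simp add: drop_bit_eq_div)

lemma and_div_power: "(a AND b) div 2 ^ d = (a div 2 ^ d) AND (b div 2 ^ d :: nat)"
  using drop_bit_and[of d a b] by (simp add: drop_bit_eq_div)

lemma xor_cancel_left: "a XOR (a XOR b) = (b :: nat)"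
  by (simp flip: xor.assoc)

lemma xor_eq_0_iff: "a XOR b = 0 \<longleftrightarrow> a = (b :: nat)"
  by (metis xor_cancel_left xor.right_neutral xor_self_eq)

lemma xor3_eq_0_iff: "x XOR y XOR z = 0 \<longleftrightarrow> x = z XOR (y :: nat)"
  by (simp add: xor_eq_0_iff xor.commute[of y z])

lemma xor3_eq_0_iff_middle: "x XOR y XOR z = 0 \<longleftrightarrow> y = x XOR (z :: nat)"
  by (metis xor.left_commute xor_eq_0_iff)

section \<open>The bound on y in terms of common bits\<close>

text \<open>Equals z AND NOT s; there is no complement on naturals.\<close>

definition common_bits :: "nat \<Rightarrow> nat \<Rightarrow> nat" where
  "common_bits z s = (z XOR s) AND z"

lemma add_xor_eq: "(z XOR s) + z = s + 2 * common_bits z s"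
  using add_eq_xor_and[of "z XOR s" z]
  by (simp add: common_bits_def xor_cancel_left xor.commute[of "z XOR s" z])

lemma le_div_iff_common_bits:
  "s \<le> ((z XOR s) + z) div (2 * n + 1) \<longleftrightarrow> n * s \<le> common_bits z s"
proof -
  have "s \<le> ((z XOR s) + z) div (2 * n + 1) \<longleftrightarrow> s * (2 * n + 1) \<le> s + 2 * common_bits z s"
    unfolding add_xor_eq by (rule less_eq_div_iff_mult_less_eq) simp
  also have "\<dots> \<longleftrightarrow> n * s \<le> common_bits z s"
    by (simp add: algebra_simps)
  finally show ?thesis .
qed

lemma div_le_iff_common_bits:
  "((z XOR s) + z) div (2 * n + 1) \<le> s \<longleftrightarrow> common_bits z s \<le> n * Suc s"
proof -
  have "((z XOR s) + z) div (2 * n + 1) < Suc s \<longleftrightarrow>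
      s + 2 * common_bits z s < Suc s * (2 * n + 1)"
    unfolding add_xor_eq by (rule div_less_iff_less_mult) simp
  \<comment> \<open>With c for the common bits this is 2c < 2n(s + 1) + 1, and parity absorbs the
    extra 1.\<close>
  also have "\<dots> \<longleftrightarrow> common_bits z s \<le> n * Suc s"
    by (auto simp: algebra_simps)
  finally show ?thesis by (simp add: less_Suc_eq_le)
qed

lemma common_bits_div_power:
  "common_bits z s div 2 ^ d = common_bits (z div 2 ^ d) (s div 2 ^ d)"
  by (simp add: common_bits_def xor_div_power and_div_power)

lemma bit_common_bits: "bit (common_bits z s) d \<longleftrightarrow> bit z d \<and> \<not> bit s d"
  by (auto simp: common_bits_def bit_and_iff bit_xor_iff)

section \<open>No move between positions of nim-sum zero\<close>

lemma no_move_between_zero_xor: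
  fixes n y y' z :: nat
  assumes "odd n" "y' < y"
    and y: "y \<le> ((z XOR y) + z) div (2 * n + 1)"
    and y': "((z XOR y') + z) div (2 * n + 1) \<le> y'"
  shows "\<not> z XOR y' < z XOR y"
proof
  assume less: "z XOR y' < z XOR y"
  obtain d where d: "\<not> bit y' d" "bit y d" "y' div 2 ^ Suc d = y div 2 ^ Suc d"
    using less_imp_highest_differing_bit[OF \<open>y' < y\<close>] .
  define E Y D where "E = (2 :: nat) ^ d" and "Y = y div 2 ^ Suc d"
    and "D = common_bits z y div 2 ^ Suc d"
  \<comment> \<open>If \<open>z\<close> had bit \<open>d\<close>, XOR with \<open>z\<close> would
    flip that bit and so reverse the order of \<open>y'\<close> and \<open>y\<close>.\<close>
  have "\<not> bit z d"
  proof
    assume "bit z d"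
    then have "z XOR y < z XOR y'"
      using d by (intro highest_differing_bit_imp_less[of _ d])
        (auto simp: bit_xor_iff xor_div_power simp del: power_Suc)
    with less show False by simp
  qed
  \<comment> \<open>Bit \<open>d\<close> vanishes in both because it does in \<open>z\<close>; above
    \<open>d\<close> the numbers \<open>y\<close> and \<open>y'\<close> agree, so one
    \<open>D\<close> serves both.\<close>
  then have C: "common_bits z y div E = 2 * D" "common_bits z y' div E = 2 * D"
    using d unfolding E_def D_def div_power_bit[of _ d] bit_common_bits
    by (simp_all add: common_bits_div_power del: power_Suc)
  have Y: "y div E = 2 * Y + 1" "y' div E = 2 * Y"
    using d unfolding E_def Y_def div_power_bit[of _ d] by simp_all
  have "E > 0" by (simp add: E_def)
  have "n * (2 * Y + 1) * E \<le> n * y"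
    using Y(1) by (metis div_times_less_eq_dividend mult.assoc mult_le_mono2)
  also have "\<dots> \<le> common_bits z y"
    using y by (simp only: le_div_iff_common_bits)
  finally have "n * (2 * Y + 1) \<le> 2 * D"
    using C(1) \<open>E > 0\<close> by (metis less_eq_div_iff_mult_less_eq)
  \<comment> \<open>The threshold \<open>(2 * Y + 1) * E\<close> separates the two numbers:
    \<open>y\<close> reaches it and \<open>y'\<close> stays strictly below. The two bounds on common
    bits therefore meet there.\<close>
  moreover have "Suc y' \<le> (2 * Y + 1) * E"
    using Y(2) \<open>E > 0\<close> by (metis Suc_eq_plus1 Suc_leI div_less_iff_less_mult lessI)
  then have "n * Suc y' \<le> n * (2 * Y + 1) * E"
    by (metis mult.assoc mult_le_mono2)
  with y' have "common_bits z y' \<le> n * (2 * Y + 1) * E"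
    by (simp only: div_le_iff_common_bits)
  then have "2 * D \<le> n * (2 * Y + 1)"
    using C(2) \<open>E > 0\<close> by (metis div_le_mono div_mult_self_is_m)
  ultimately have "2 * D = n * (2 * Y + 1)" by simp
  \<comment> \<open>Here k being 3 modulo 4 enters, as oddness of \<open>n\<close>.\<close>
  moreover have "odd (n * (2 * Y + 1))" using \<open>odd n\<close> by simp
  ultimately show False by (metis dvd_triv_left)
qed

section \<open>Moves to nim-sum zero\<close>

text \<open>Passing from \<open>s\<close> to \<open>Suc s\<close> switches on one bit
  \<open>d\<close> and clears the bits below it. If the common bits jumped from strictly above
  \<open>n * Suc s\<close> to strictly below, bit \<open>d\<close> of \<open>z\<close> would have to
  account for the jump; but the low bits of \<open>s\<close> are all 1, so the upper value is
  exactly \<open>n * Suc s\<close>.\<close>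

lemma common_bits_le_if_Suc_infeasible:
  assumes "common_bits z (Suc s) < n * Suc s"
  shows "common_bits z s \<le> n * Suc s"
proof (rule ccontr)
  assume "\<not> common_bits z s \<le> n * Suc s"
  then have gt: "n * Suc s < common_bits z s" by simp
  obtain d where d: "\<not> bit s d" "bit (Suc s) d" "s div 2 ^ Suc d = Suc s div 2 ^ Suc d"
    using less_imp_highest_differing_bit[OF lessI] .
  define E S D where "E = (2 :: nat) ^ d" and "S = s div 2 ^ Suc d"
    and "D = common_bits z s div 2 ^ Suc d"
  have "E > 0" by (simp add: E_def)
  have S: "s div E = 2 * S" "Suc s div E = 2 * S + 1"
    using d unfolding E_def S_def div_power_bit[of _ d] by simp_all
  have C: "common_bits z s div E = 2 * D + of_bool (bit z d)" "common_bits z (Suc s) div E = 2 * D"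
    using d unfolding E_def D_def div_power_bit[of _ d] bit_common_bits
    by (simp_all add: common_bits_div_power del: power_Suc)
  \<comment> \<open>The carry stops at bit \<open>d\<close>, so \<open>Suc s\<close> is a multiple
    of \<open>E\<close>.\<close>
  have s: "Suc s = (2 * S + 1) * E"
  proof (rule antisym)
    show "Suc s \<le> (2 * S + 1) * E"
      using S(1) \<open>E > 0\<close> by (metis Suc_eq_plus1 Suc_leI div_less_iff_less_mult lessI)
    show "(2 * S + 1) * E \<le> Suc s"
      using S(2) by (metis div_times_less_eq_dividend)
  qed
  have lower: "n * (2 * S + 1) \<le> 2 * D + of_bool (bit z d)"
    using gt C(1) \<open>E > 0\<close> unfolding s
    by (metis less_eq_div_iff_mult_less_eq less_imp_le mult.assoc)
  have upper: "2 * D < n * (2 * S + 1)"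
    using assms C(2) \<open>E > 0\<close> unfolding s by (metis div_less_iff_less_mult mult.assoc)
  from lower upper have "bit z d" and eq: "n * (2 * S + 1) = 2 * D + 1"
    by (cases "bit z d"; simp)+
  have "s = 2 * S * E + (E - 1)"
    using s \<open>E > 0\<close> by (simp add: algebra_simps)
  then have "s mod E = (E - 1) mod E"
    by (simp only: mod_mult_self3)
  then have "s mod E = E - 1"
    using \<open>E > 0\<close> by simp
  then have "take_bit d s = E - 1"
    by (simp add: take_bit_eq_mod E_def)
  then have "take_bit d s = mask d"
    by (simp add: mask_eq_exp_minus_1 E_def)
  then have "bit s i" if "i < d" for i
    using that by (metis bit_take_bit_iff bit_mask_iff possible_bit_nat)
  \<comment> \<open>Ones in the low part of \<open>s\<close> mask the low part of \<open>z\<close>,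
    so no remainder is left that could make the inequality strict.\<close>
  then have "take_bit d (common_bits z s) = 0"
    by (intro bit_eqI) (simp add: bit_take_bit_iff bit_common_bits)
  then have "common_bits z s = (2 * D + 1) * E"
    using C(1) \<open>bit z d\<close> by (metis E_def add.right_neutral div_mult_mod_eq of_bool_eq(2) take_bit_eq_mod)
  with gt eq show False unfolding s by (metis less_irrefl mult.assoc)
qed

lemma ex_move_to_zero_xor:
  fixes n x y z :: nat
  assumes y: "y \<le> (x + z) div (2 * n + 1)"
    and d: "bit x d" "\<not> bit y d" "\<not> bit z d"
    and upper: "x div 2 ^ Suc d = (z div 2 ^ Suc d) XOR (y div 2 ^ Suc d)"
  obtains u where "u < x" "u XOR min y ((u + z) div (2 * n + 1)) XOR z = 0"
proof -
  define E Y Z where "E = (2 :: nat) ^ d" and "Y = y div 2 ^ Suc d" and "Z = z div 2 ^ Suc d"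
  define P where "P s \<longleftrightarrow> n * s \<le> common_bits z s" for s
  \<comment> \<open>This is \<open>y\<close> with bits 0 to \<open>d\<close> cleared, the start of
    the search.\<close>
  define y0 where "y0 = Y * 2 ^ Suc d"
  have "y0 \<le> y"
    unfolding y0_def Y_def by (rule div_times_less_eq_dividend)
  \<comment> \<open>Cutting off the low digits of \<open>x\<close> and \<open>z\<close> loses less
    than one unit of \<open>2 ^ Suc d\<close> each. Hence (2n + 1)Y < Y + 2c + 2 with c =
    \<open>common_bits Z Y\<close>, which still gives nY \<le> c.\<close>
  have "n * Y \<le> common_bits Z Y"
  proof -
    have "(2 * n + 1) * Y * 2 ^ Suc d \<le> (2 * n + 1) * y"
      using \<open>y0 \<le> y\<close> unfolding y0_def by (metis mult.assoc mult_le_mono2)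
    also have "\<dots> \<le> x + z"
      using y less_eq_div_iff_mult_less_eq[of "2 * n + 1" y "x + z"] by (simp add: mult.commute)
    also have "\<dots> < (x div 2 ^ Suc d + Z + 2) * 2 ^ Suc d"
    proof -
      have "x < (x div 2 ^ Suc d + 1) * 2 ^ Suc d" "z < (Z + 1) * 2 ^ Suc d"
        unfolding Z_def by (metis div_less_iff_less_mult less_add_one zero_less_numeral zero_less_power)+
      then show ?thesis by (simp add: algebra_simps)
    qed
    finally have "(2 * n + 1) * Y < x div 2 ^ Suc d + Z + 2"
      by (metis mult_less_cancel2)
    also have "x div 2 ^ Suc d + Z = Y + 2 * common_bits Z Y"
      unfolding upper Z_def Y_def by (rule add_xor_eq)
    finally show ?thesis by (simp add: algebra_simps)
  qed
  have "P y0"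
  proof -
    have "n * y0 \<le> common_bits Z Y * 2 ^ Suc d"
      using \<open>n * Y \<le> common_bits Z Y\<close> unfolding y0_def by (metis mult.assoc mult_le_mono1)
    also have "common_bits Z Y = common_bits z y0 div 2 ^ Suc d"
      by (simp add: common_bits_div_power Z_def y0_def del: power_Suc)
    also have "\<dots> * 2 ^ Suc d \<le> common_bits z y0"
      by (rule div_times_less_eq_dividend)
    finally show ?thesis by (simp add: P_def)
  qed
  \<comment> \<open>Walk up from \<open>y0\<close> while \<open>P\<close> holds, stopping at the
    first failure or at \<open>y\<close>.\<close>
  have "\<exists>s. y0 \<le> s \<and> s \<le> y \<and> P s \<and> (s = y \<or> \<not> P (Suc s))"
    using \<open>y0 \<le> y\<close>
  proof (induction rule: dec_induct)
    case base
    then show ?case using \<open>P y0\<close> by blast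
  next
    case (step m)
    then show ?case by (metis le_Suc_eq)
  qed
  then obtain s where s: "y0 \<le> s" "s \<le> y" "P s" "s = y \<or> \<not> P (Suc s)"
    by blast
  have "s div E = 2 * Y"
  proof (rule antisym)
    have "y div E = 2 * Y"
      using d unfolding E_def Y_def div_power_bit[of _ d] by simp
    then show "s div E \<le> 2 * Y" using div_le_mono[OF s(2), of E] by simp
    have "y0 div E = 2 * Y" by (simp add: y0_def E_def)
    then show "2 * Y \<le> s div E" using div_le_mono[OF s(1), of E] by simp
  qed
  then have "2 * (s div 2 ^ Suc d) + of_bool (bit s d) = 2 * Y"
    unfolding E_def div_power_bit[of s d] .
  moreover from this have "\<not> bit s d"
    by (metis dvd_triv_left even_add odd_one of_bool_eq(2))
  ultimately have sd: "\<not> bit s d" "s div 2 ^ Suc d = Y"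
    by simp_all
  \<comment> \<open>Since \<open>s\<close> lies between \<open>y0\<close> and \<open>y\<close>, it
    shares their digits from \<open>d\<close> upwards; at bit \<open>d\<close> only \<open>x\<close>
    has a 1.\<close>
  have "z XOR s < x"
    using d sd upper by (intro highest_differing_bit_imp_less[of _ d])
      (simp_all add: bit_xor_iff xor_div_power Y_def del: power_Suc)
  moreover have "s \<le> ((z XOR s) + z) div (2 * n + 1)"
    using s(3) unfolding P_def le_div_iff_common_bits .
  moreover have "((z XOR s) + z) div (2 * n + 1) \<le> s" if "\<not> P (Suc s)"
    using that common_bits_le_if_Suc_infeasible unfolding P_def div_le_iff_common_bits by simp
  \<comment> \<open>If the search stopped at \<open>y\<close>, the cut does not lower
    \<open>y\<close>; otherwise the quotient is squeezed to exactly \<open>s\<close>.\<close>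
  ultimately have "min y (((z XOR s) + z) div (2 * n + 1)) = s"
    using s(2,4) by (metis min.absorb1 min.absorb2 le_antisym)
  then have "(z XOR s) XOR min y (((z XOR s) + z) div (2 * n + 1)) XOR z = 0"
    by (simp add: xor.assoc xor.left_commute)
  with \<open>z XOR s < x\<close> show ?thesis by (rule that)
qed

section \<open>Strategies and kernels\<close>

lemma player_to_move_take_Suc:
  "i < length ps \<Longrightarrow> player_to_move (take (Suc i) ps) = (if even i then Next else Previous)"
  by (simp add: player_to_move_def min_absorb2 del: take_Suc)

lemma follows_snoc:
  assumes "h \<noteq> []"
  shows "follows P \<sigma> (h @ [a]) \<longleftrightarrow> follows P \<sigma> h \<and> (player_to_move h = P \<longrightarrow> a = \<sigma> h)"
proof -
  define m where "m = length h - 1"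
  have m: "length h = Suc m"
    using assms by (simp add: m_def)
  have "follows P \<sigma> (h @ [a]) \<longleftrightarrow>
      (\<forall>i<Suc m. player_to_move (take (Suc i) (h @ [a])) = P
        \<longrightarrow> (h @ [a]) ! Suc i = \<sigma> (take (Suc i) (h @ [a])))"
    by (simp add: follows_def m imp_conjL)
  also have "\<dots> \<longleftrightarrow> (\<forall>i<m. player_to_move (take (Suc i) h) = P
        \<longrightarrow> h ! Suc i = \<sigma> (take (Suc i) h)) \<and> (player_to_move h = P \<longrightarrow> a = \<sigma> h)"
    unfolding All_less_Suc by (auto simp: nth_append m)
  also have "\<dots> \<longleftrightarrow> follows P \<sigma> h \<and> (player_to_move h = P \<longrightarrow> a = \<sigma> h)"
    by (simp add: follows_def m imp_conjL)
  finally show ?thesis .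
qed

text \<open>Let the two strategies play against each other; the coordinate sum drops with every
  move, so the play ends. The induction is over partial plays that already follow both
  strategies.\<close>

lemma ex_complete_play:
  assumes "strategy k \<sigma>" "strategy k \<tau>"
  shows "\<exists>ps. complete_play k p ps \<and> follows Next \<sigma> ps \<and> follows Previous \<tau> ps"
proof -
  have extend: "\<exists>ps. complete_play k p ps \<and> follows Next \<sigma> ps \<and> follows Previous \<tau> ps"
    if "h \<noteq> []" "hd h = p" "\<forall>i. Suc i < length h \<longrightarrow> h ! Suc i \<in> move k (h ! i)"
      "follows Next \<sigma> h" "follows Previous \<tau> h" for h
    using that
  proof (induction "case last h of (x, y, z) \<Rightarrow> x + y + z" arbitrary: h rule: less_induct)
    case less
    show ?case
    proof (cases "move k (last h) = {}")
      case True
      with less.prems show ?thesis unfolding complete_play_def by blast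
    next
      case False
      define a where "a = (if player_to_move h = Next then \<sigma> h else \<tau> h)"
      have a: "a \<in> move k (last h)"
        using assms False less.prems(1) by (simp add: a_def strategy_def)
      show ?thesis
      proof (rule less.hyps[of "h @ [a]"])
        show "(case last (h @ [a]) of (x, y, z) \<Rightarrow> x + y + z) < (case last h of (x, y, z) \<Rightarrow> x + y + z)"
          using a move_decreases by (cases "last h"; cases a) fastforce
        show "\<forall>i. Suc i < length (h @ [a]) \<longrightarrow> (h @ [a]) ! Suc i \<in> move k ((h @ [a]) ! i)"
        proof (intro allI impI)
          fix i
          assume "Suc i < length (h @ [a])"
          then consider "Suc i < length h" | "Suc i = length h"
            by fastforce
          then show "(h @ [a]) ! Suc i \<in> move k ((h @ [a]) ! i)"
          proof cases
            case 1
            with less.prems(3) show ?thesis by (simp add: nth_append)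
          next
            case 2
            then have "h ! i = last h"
              by (metis diff_Suc_1 last_conv_nth less.prems(1))
            with 2 a show ?thesis by (simp add: nth_append)
          qed
        qed
      qed (use less.prems in \<open>auto simp: follows_snoc a_def\<close>)
    qed
  qed
  show ?thesis
    by (rule extend[of "[p]"]) (simp_all add: follows_def)
qed

text \<open>Two winning strategies played against each other would yield a complete play with
  neither player left to move.\<close>

lemma not_both_can_force_win:
  "\<not> (can_force_win k Next p \<and> can_force_win k Previous p)"
proof
  assume "can_force_win k Next p \<and> can_force_win k Previous p"
  then obtain \<sigma> \<tau> where "strategy k \<sigma>" "strategy k \<tau>"
    and win: "\<And>ps. complete_play k p ps \<Longrightarrow> follows Next \<sigma> ps \<Longrightarrow> player_to_move ps \<noteq> Next"
      "\<And>ps. complete_play k p ps \<Longrightarrow> follows Previous \<tau> ps \<Longrightarrow> player_to_move ps \<noteq> Previous"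
    unfolding can_force_win_def by blast
  then obtain ps where "complete_play k p ps" "follows Next \<sigma> ps" "follows Previous \<tau> ps"
    using ex_complete_play by blast
  with win show False by (cases "player_to_move ps") blast+
qed

text \<open>One strategy serves both players: move into \<open>K\<close> whenever possible. It keeps
  the position in \<open>K\<close> exactly when the opponent is to move.\<close>

lemma can_force_win_by_kernel:
  assumes dominating: "\<And>p. p \<in> positions k \<Longrightarrow> p \<notin> K \<Longrightarrow> move k p \<inter> K \<noteq> {}"
    and independent: "\<And>p. p \<in> K \<Longrightarrow> move k p \<inter> K = {}"
    and p: "p \<in> positions k" "p \<in> K \<longleftrightarrow> P = Previous"
  shows "can_force_win k P p"
proof -
  \<comment> \<open>When \<open>K\<close> is out of reach any legal move is taken, since a strategy
    must be legal on all histories.\<close>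
  define \<sigma> where "\<sigma> h = (let M = move k (last h) in
      SOME q. q \<in> (if M \<inter> K = {} then M else M \<inter> K))" for h
  have into_K: "\<sigma> h \<in> move k (last h) \<inter> K" if "move k (last h) \<inter> K \<noteq> {}" for h
    using that some_in_eq[of "move k (last h) \<inter> K"] by (simp add: \<sigma>_def)
  have legal: "\<sigma> h \<in> move k (last h)" if "move k (last h) \<noteq> {}" for h
    using that into_K[of h] some_in_eq[of "move k (last h)"]
    by (cases "move k (last h) \<inter> K = {}") (auto simp: \<sigma>_def)
  have "player_to_move ps \<noteq> P" if play: "complete_play k p ps" and follows: "follows P \<sigma> ps" for ps
  proof -
    have ps: "ps \<noteq> []" "hd ps = p" "move k (last ps) = {}"
      and step: "\<And>i. Suc i < length ps \<Longrightarrow> ps ! Suc i \<in> move k (ps ! i)"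
      using play by (auto simp: complete_play_def)
    have inv: "ps ! i \<in> positions k \<and> (ps ! i \<in> K \<longleftrightarrow> player_to_move (take (Suc i) ps) \<noteq> P)"
      if "i < length ps" for i
      using that
    proof (induction i)
      case 0
      then have "ps ! 0 = p" using ps by (simp add: hd_conv_nth)
      with 0 p show ?case by (cases P) (simp_all add: player_to_move_take_Suc del: take_Suc)
    next
      case (Suc i)
      then have IH: "ps ! i \<in> positions k" "ps ! i \<in> K \<longleftrightarrow> player_to_move (take (Suc i) ps) \<noteq> P"
        by simp_all
      have mv: "ps ! Suc i \<in> move k (ps ! i)" using step Suc.prems by blast
      have alternate: "player_to_move (take (Suc (Suc i)) ps) \<noteq> P \<longleftrightarrow> player_to_move (take (Suc i) ps) = P"
        using Suc.prems by (cases P) (simp_all add: player_to_move_take_Suc)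
      have "ps ! Suc i \<in> K \<longleftrightarrow> player_to_move (take (Suc i) ps) = P"
      proof (cases "player_to_move (take (Suc i) ps) = P")
        case True
        have "last (take (Suc i) ps) = ps ! i"
          using Suc.prems by (simp add: take_Suc_conv_app_nth)
        with True IH have "\<sigma> (take (Suc i) ps) \<in> K"
          using dominating into_K by (metis IntD2)
        moreover have "ps ! Suc i = \<sigma> (take (Suc i) ps)"
          using follows True Suc.prems unfolding follows_def by blast
        ultimately show ?thesis using True by simp
      next
        case False
        with IH mv independent show ?thesis by blast
      qed
      with alternate move_in_positions[OF IH(1) mv] show ?case by simp
    qed
    \<comment> \<open>A position without moves lies in \<open>K\<close> by domination, so the
      opponent is the one left without a move.\<close>
    have "last ps \<in> positions k \<and> (last ps \<in> K \<longleftrightarrow> player_to_move ps \<noteq> P)"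
      using inv[of "length ps - 1"] ps(1) by (simp add: last_conv_nth)
    with ps(3) dominating show ?thesis by blast
  qed
  with legal show ?thesis
    unfolding can_force_win_def strategy_def by blast
qed

text \<open>The kernel strategy gives a winner on each side of \<open>K\<close>; the converses
  follow because the two players cannot both force a win.\<close>

lemma outcome_sets_by_kernel:
  assumes "K \<subseteq> positions k"
    and "\<And>p. p \<in> positions k \<Longrightarrow> p \<notin> K \<Longrightarrow> move k p \<inter> K \<noteq> {}"
    and "\<And>p. p \<in> K \<Longrightarrow> move k p \<inter> K = {}"
  shows "P_positions k = K" "N_positions k = positions k - K"
proof -
  have "can_force_win k Previous p \<longleftrightarrow> p \<in> K" "can_force_win k Next p \<longleftrightarrow> p \<notin> K"
    if "p \<in> positions k" for p
    using can_force_win_by_kernel[OF assms(2,3) that] not_both_can_force_win[of k p]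
    by (metis player.distinct(1))+
  with assms(1) show "P_positions k = K" "N_positions k = positions k - K"
    by (auto simp: P_positions_def N_positions_def)
qed

section \<open>The kernel of the chocolate bar game\<close>

lemma side_move_not_zero_xor:
  fixes n u x y z :: nat
  assumes "odd n" "x XOR y XOR z = 0" "y \<le> (x + z) div (2 * n + 1)" "u < x"
  shows "u XOR min y ((u + z) div (2 * n + 1)) XOR z \<noteq> 0"
proof
  define y' where "y' = min y ((u + z) div (2 * n + 1))"
  assume "u XOR min y ((u + z) div (2 * n + 1)) XOR z = 0"
  then have u: "u = z XOR y'"
    by (simp only: xor3_eq_0_iff flip: y'_def)
  have x: "x = z XOR y"
    using assms(2) by (simp only: xor3_eq_0_iff)
  \<comment> \<open>Equal middle coordinates would give \<open>u = x\<close>; so \<open>y\<close> is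
    forced down and the minimum is the quotient.\<close>
  from u x \<open>u < x\<close> have "y' < y"
    by (auto simp: y'_def min_def split: if_splits)
  moreover from this have "((z XOR y') + z) div (2 * n + 1) \<le> y'"
    unfolding u[symmetric] by (simp add: y'_def min_def split: if_splits)
  ultimately show False
    using no_move_between_zero_xor[OF \<open>odd n\<close>] assms(3,4) u x by blast
qed

lemma ex_zero_xor_move:
  assumes "(x, y, z) \<in> positions (2 * n + 1)" "x XOR y XOR z \<noteq> 0"
  shows "move (2 * n + 1) (x, y, z) \<inter> {(x, y, z). x XOR y XOR z = 0} \<noteq> {}"
proof -
  have y: "y \<le> (x + z) div (2 * n + 1)"
    using assms(1) by (simp add: positions_def)
  have "0 < x XOR y XOR z"
    using assms(2) by simp
  then obtain d where "bit (x XOR y XOR z) d" and "0 div 2 ^ Suc d = (x XOR y XOR z) div 2 ^ Suc d"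
    by (rule less_imp_highest_differing_bit)
  \<comment> \<open>The chained equivalence says that an odd number of the three bits is set, as at
    the leading bit of the nim-sum.\<close>
  then have d: "bit x d \<longleftrightarrow> bit y d \<longleftrightarrow> bit z d"
    and upper: "(x div 2 ^ Suc d) XOR (y div 2 ^ Suc d) XOR (z div 2 ^ Suc d) = 0"
    by (auto simp: bit_xor_iff xor_div_power simp del: power_Suc)
  from d consider "bit y d" | "bit x d" "\<not> bit y d" "\<not> bit z d" | "bit z d" "\<not> bit y d" "\<not> bit x d"
    by blast
  then show ?thesis
  proof cases
    case 1
    have "(x div 2 ^ Suc d) XOR (z div 2 ^ Suc d) = y div 2 ^ Suc d"
      using upper by (simp only: xor3_eq_0_iff_middle)
    then have "x XOR z < y"
      using 1 d by (intro highest_differing_bit_imp_less[of _ d])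
        (auto simp: bit_xor_iff xor_div_power simp del: power_Suc)
    then have "(x, x XOR z, z) \<in> move (2 * n + 1) (x, y, z)"
      by simp
    moreover have "x XOR (x XOR z) XOR z = 0"
      by (simp only: xor3_eq_0_iff_middle)
    ultimately show ?thesis by blast
  next
    case 2
    have "x div 2 ^ Suc d = (z div 2 ^ Suc d) XOR (y div 2 ^ Suc d)"
      using upper by (simp only: xor3_eq_0_iff)
    then obtain u where "u < x" "u XOR min y ((u + z) div (2 * n + 1)) XOR z = 0"
      using ex_move_to_zero_xor[OF y 2] by blast
    then show ?thesis by auto
  next
    case 3
    have "z div 2 ^ Suc d = (x div 2 ^ Suc d) XOR (y div 2 ^ Suc d)"
      using upper by (metis xor.assoc xor_eq_0_iff)
    \<comment> \<open>The game is symmetric in \<open>x\<close> and \<open>z\<close>, so the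
      previous case applies with these exchanged.\<close>
    then obtain w where "w < z" "w XOR min y ((w + x) div (2 * n + 1)) XOR x = 0"
      using ex_move_to_zero_xor[OF _ 3, of n] y by (metis add.commute)
    then have "w < z" "x XOR min y ((x + w) div (2 * n + 1)) XOR w = 0"
      by (simp_all add: xor.commute xor.left_commute add.commute)
    then show ?thesis by auto
  qed
qed

theorem theorem7p3:
  fixes k m :: nat and A B :: "(nat \<times> nat \<times> nat) set"
  assumes "k = 4 * m + 3"
  defines "A \<equiv> {(x, y, z). y \<le> (x + z) div k \<and> x XOR y XOR z = 0}"
  defines "B \<equiv> {(x, y, z). y \<le> (x + z) div k \<and> x XOR y XOR z \<noteq> 0}"
  shows "A = P_positions k \<and> B = N_positions k"
proof -
  define n where "n = 2 * m + 1"
  have k: "k = 2 * n + 1" and "odd n"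
    by (simp_all add: n_def assms(1))
  have "A \<subseteq> positions k" and B: "B = positions k - A"
    by (auto simp: A_def B_def positions_def)
  moreover have "move k p \<inter> A \<noteq> {}" if "p \<in> positions k" "p \<notin> A" for p
  proof -
    obtain x y z where p: "p = (x, y, z)" by (cases p)
    have "move k p \<inter> {(x, y, z). x XOR y XOR z = 0} \<noteq> {}"
      using that ex_zero_xor_move[of x y z n] unfolding p k by (auto simp: A_def positions_def k)
    with move_in_positions[OF that(1)] show ?thesis
      by (fastforce simp: A_def positions_def)
  qed
  moreover have "move k p \<inter> A = {}" if "p \<in> A" for p
  proof -
    obtain x y z where p: "p = (x, y, z)" by (cases p)
    have y: "y \<le> (x + z) div k" and zero: "x XOR y XOR z = 0"
      using that by (auto simp: p A_def)
    have "u XOR min y ((u + z) div k) XOR z \<noteq> 0" if "u < x" for u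
      using side_move_not_zero_xor[OF \<open>odd n\<close> zero] y that unfolding k by blast
    moreover have "x XOR min y ((x + w) div k) XOR w \<noteq> 0" if "w < z" for w
      using side_move_not_zero_xor[OF \<open>odd n\<close>, of z y x w] y zero that unfolding k
      by (simp add: xor.commute xor.left_commute add.commute)
    \<comment> \<open>With \<open>x\<close> and \<open>z\<close> fixed, nim-sum zero determines the
      middle coordinate.\<close>
    moreover have "x XOR v XOR z \<noteq> 0" if "v < y" for v
      using zero that unfolding xor3_eq_0_iff_middle by simp
    ultimately show ?thesis unfolding p A_def move.simps by blast
  qed
  ultimately show ?thesis
    using outcome_sets_by_kernel[of A k] by blast
qed

end
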